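(* Let $\mathbb{K}$ be a field with $\mathrm{char}(\mathbb{K})\neq 2$. Let $n\in\mathbb{Z}_{>0}$ and let $\Omega\in M_{2n\times 2n}(\mathbb{K})$ be the $2\times 2$-block matrix $$\Omega=\begin{bmatrix} O_n & I_n\\ -I_n & O_n\end{bmatrix},$$ where $I_n\in M_{n\times n}(\mathbb{K})$ is the identity matrix and $O_n\in M_{n\times n}(\mathbb{K})$ is the zero matrix. Let $A\in M_{2n\times 2n}(\mathbb{K})$ be such that $$A^T=\Omega A\Omega^{-1}.$$ Then: (i) If all the eigenvalues of $A$ are in $\mathbb{K}$, then there exists a symplectic matrix $C\in M_{2n\times 2n}(\mathbb{K})$ such that $$C^{-1}AC=\begin{bmatrix} B & O_n\\ O_n & B^T\end{bmatrix}$$ for some $B\in M_{n\times n}(\mathbb{K})$ in Jordan normal form. (ii) If $\mathbb{K}$ is perfect, then there exists a symplectic matrix $C\in M_{2n\times 2n}(\mathbb{K})$ such that $$C^{-1}AC=\begin{bmatrix} B & O_n\\ O_n & B^T\end{bmatrix}$$ for some $B\in M_{n\times n}(\mathbb{K})$.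
   Context: A matrix $C\in M_{2n\times 2n}(\mathbb{K})$ is called symplectic if $C^T\Omega C=\Omega$. "All the eigenvalues of $A$ are in $\mathbb{K}$" means that the characteristic polynomial of $A$ splits into linear factors over $\mathbb{K}$. Jordan normal form means block diagonal with Jordan blocks (a constant eigenvalue on the diagonal, ones on the superdiagonal, zeros elsewhere). *)

theory Defs
  imports
    "HOL-Algebra.Algebraic_Closure_Type"
    "Jordan_Normal_Form.Jordan_Normal_Form"
    "Jordan_Normal_Form.Gauss_Jordan_Elimination"
begin

text \<open>A field is perfect if every irreducible polynomial over it is separable, i.e. has no
  multiple root in the algebraic closure. The qualifier selects the type-class notion of
  irreducibility rather than the locale-based one of HOL-Algebra.\<close>

definition perfect_field :: "'a :: field itself \<Rightarrow> bool" where
  "perfect_field _ \<longleftrightarrow>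
     (\<forall>p :: 'a poly. Factorial_Ring.irreducible p \<longrightarrow> rsquarefree (map_poly to_ac p))"

text \<open>Meaningful for invertible square matrices only; otherwise the result is unspecified.\<close>

definition mat_inv :: "'a :: field mat \<Rightarrow> 'a mat" where
  "mat_inv M = the (mat_inverse M)"

lemma mat_inv_eqI:
  assumes M: "M \<in> carrier_mat n n" and N: "N \<in> carrier_mat n n"
    and MN: "M * N = 1\<^sub>m n" and NM: "N * M = 1\<^sub>m n"
  shows "mat_inv M = N"
proof -
  have "M \<in> Units (ring_mat TYPE('a :: field) n ())"
    using M N MN NM by (auto simp: Units_def ring_mat_def)
  then obtain L where L: "mat_inverse M = Some L"
    using mat_inverse(1)[OF M, of "()"] by (cases "mat_inverse M") auto
  have M_L: "M * L = 1\<^sub>m n" and L_carrier: "L \<in> carrier_mat n n"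
    using mat_inverse(2)[OF M L] by auto
  have "L = (N * M) * L"
    using NM L_carrier by simp
  also have "\<dots> = N * (M * L)"
    by (rule assoc_mult_mat[OF N M L_carrier])
  also have "\<dots> = N"
    using M_L N by simp
  finally show ?thesis
    using L by (simp add: mat_inv_def)
qed

definition Omega :: "nat \<Rightarrow> 'a :: comm_ring_1 mat" where
  "Omega n = four_block_mat (0\<^sub>m n n) (1\<^sub>m n) (- 1\<^sub>m n) (0\<^sub>m n n)"

definition symplectic :: "nat \<Rightarrow> 'a :: comm_ring_1 mat \<Rightarrow> bool" where
  "symplectic n C \<longleftrightarrow> C \<in> carrier_mat (2 * n) (2 * n) \<and> C\<^sup>T * Omega n * C = Omega n"

text \<open>A characteristic polynomial is monic, so no leading coefficient is needed.\<close>

definition all_eigenvalues_in_field :: "'a :: field mat \<Rightarrow> bool" where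
  "all_eigenvalues_in_field M \<longleftrightarrow> (\<exists>as. char_poly M = (\<Prod>a\<leftarrow>as. [:- a, 1:]))"

text \<open>In contrast to \<open>jordan_nf\<close>, which only asks for similarity, the matrix itself
  is a block diagonal matrix of (nonempty) Jordan blocks.\<close>

definition in_jordan_normal_form :: "'a :: field mat \<Rightarrow> bool" where
  "in_jordan_normal_form M \<longleftrightarrow> (\<exists>n_as. 0 \<notin> fst ` set n_as \<and> M = jordan_matrix n_as)"

end

(* The form \<omega>(u, v) = u\<^sup>T \<Omega> v is alternating and A is self-adjoint for it, so, as 2 \<noteq> 0, every cyclic
   subspace K[A]v is isotropic. Take v with K[A]v of maximal dimension d, and w with
   \<omega>(A\<^sup>i v, w) = 0 for i < d - 1 and \<omega>(A\<^bsup>d-1\<^esup> v, w) = 1. The Hankel matrix \<omega>(A\<^sup>i v, A\<^sup>j w), i, j < d, is then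
   antitriangular, and maximality of d forces dim K[A]w = d, so K[A]v and K[A]w are A-invariant isotropic
   subspaces in perfect duality. Splitting off their sum and repeating the argument in its orthogonal complement
   yields two complementary invariant Lagrangian subspaces with dual bases, i.e. a symplectic C with
   C\<^sup>-\<^sup>1 A C = diag(B, B\<^sup>T). If the characteristic polynomial splits, B = P J P\<^sup>-\<^sup>1 with J in Jordan normal
   form, and one replaces C by C diag(P, P\<^bsup>-T\<^esup>). *)
theory Submission
  imports Defs "HOL-Library.Function_Algebras" "Jordan_Normal_Form.Jordan_Normal_Form_Existence"
begin

section \<open>Self-adjoint endomorphisms of a symplectic space\<close>

text \<open>\<open>E\<close> is a basis of the space under study, so \<open>span E\<close> is
  finite-dimensional although the type \<open>'v\<close> may be larger. The algebraic laws of
  \<open>\<omega>\<close> and \<open>T\<close> hold on the whole type; nondegeneracy and invariance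
  concern \<open>span E\<close>. Skew symmetry together with \<open>2 \<noteq> 0\<close> makes the
  form alternating.\<close>

locale selfadjoint_form = vector_space scale
  for scale :: "'a :: field \<Rightarrow> 'v :: ab_group_add \<Rightarrow> 'v" (infixr \<open>*s\<close> 75) +
  fixes E :: "'v set" and \<omega> :: "'v \<Rightarrow> 'v \<Rightarrow> 'a" and T :: "'v \<Rightarrow> 'v"
  assumes two_neq_0: "(2 :: 'a) \<noteq> 0"
    and finite_E: "finite E"
    and independent_E: "independent E"
    and form_add_left: "\<omega> (u + v) w = \<omega> u w + \<omega> v w"
    and form_scale_left: "\<omega> (c *s v) w = c * \<omega> v w"
    and form_skew: "\<omega> v w = - \<omega> w v"
    and form_nondegenerate: "v \<in> span E \<Longrightarrow> v \<noteq> 0 \<Longrightarrow> \<exists>w\<in>span E. \<omega> v w \<noteq> 0"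
    and T_add: "T (u + v) = T u + T v"
    and T_scale: "T (c *s v) = c *s T v"
    and T_closed: "v \<in> span E \<Longrightarrow> T v \<in> span E"
    and T_selfadjoint: "\<omega> (T v) w = \<omega> v (T w)"
begin

section \<open>Bilinearity of the form\<close>

lemma form_add_right: "\<omega> w (u + v) = \<omega> w u + \<omega> w v"
  using form_add_left[of u v w] form_skew[of w "u + v"] form_skew[of w u] form_skew[of w v] by simp

lemma form_scale_right: "\<omega> w (c *s v) = c * \<omega> w v"
  using form_scale_left[of c v w] form_skew[of w "c *s v"] form_skew[of w v] by simp

lemma form_zero_left [simp]: "\<omega> 0 w = 0"
  using form_scale_left[of 0 0 w] by simp

lemma form_zero_right [simp]: "\<omega> w 0 = 0"
  using form_scale_right[of w 0 0] by simp

lemma form_minus_left: "\<omega> (- v) w = - \<omega> v w"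
  using form_scale_left[of "-1" v w] by simp

lemma form_minus_right: "\<omega> w (- v) = - \<omega> w v"
  using form_scale_right[of w "-1" v] by simp

lemma form_diff_left: "\<omega> (u - v) w = \<omega> u w - \<omega> v w"
  using form_add_left[of u "- v" w] by (simp add: form_minus_left)

lemma form_diff_right: "\<omega> w (u - v) = \<omega> w u - \<omega> w v"
  using form_add_right[of w u "- v"] by (simp add: form_minus_right)

lemma form_sum_left: "\<omega> (\<Sum>i\<in>I. f i) w = (\<Sum>i\<in>I. \<omega> (f i) w)"
  by (induction I rule: infinite_finite_induct) (auto simp: form_add_left)

lemma form_sum_right: "\<omega> w (\<Sum>i\<in>I. f i) = (\<Sum>i\<in>I. \<omega> w (f i))"
  by (induction I rule: infinite_finite_induct) (auto simp: form_add_right)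

lemmas form_linear =
  form_add_left form_add_right form_diff_left form_diff_right form_scale_left form_scale_right
  form_sum_left form_sum_right

lemma form_span_left_zero: "v \<in> span S \<Longrightarrow> (\<And>s. s \<in> S \<Longrightarrow> \<omega> s w = 0) \<Longrightarrow> \<omega> v w = 0"
  by (induction rule: span_induct_alt) (auto simp: form_linear)

lemma form_span_right_zero: "v \<in> span S \<Longrightarrow> (\<And>s. s \<in> S \<Longrightarrow> \<omega> w s = 0) \<Longrightarrow> \<omega> w v = 0"
  by (induction rule: span_induct_alt) (auto simp: form_linear)

section \<open>Powers of \<open>T\<close> and isotropy of cyclic subspaces\<close>

lemma T_span:
  assumes "v \<in> span S" "\<And>s. s \<in> S \<Longrightarrow> T s \<in> span S'"
  shows "T v \<in> span S'"
  using assms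
proof (induction rule: span_induct_alt)
  case base
  then show ?case using T_scale[of 0 0] by (simp add: span_zero)
next
  case (step c x y)
  then show ?case by (auto simp: T_add T_scale intro!: span_add span_scale)
qed

lemma T_power_closed: "v \<in> span E \<Longrightarrow> (T ^^ i) v \<in> span E"
  by (induction i) (auto intro: T_closed)

lemma T_power_selfadjoint: "\<omega> ((T ^^ i) v) w = \<omega> v ((T ^^ i) w)"
  by (induction i arbitrary: v w) (auto simp: T_selfadjoint funpow_swap1)

text \<open>All powers can be moved to one side, leaving \<open>\<omega> v ((T ^^ m) v)\<close>; by
  self-adjointness and skew symmetry this is its own negative, and
  \<open>2 \<noteq> 0\<close>.\<close>

lemma cyclic_isotropic: "\<omega> ((T ^^ i) v) ((T ^^ j) v) = 0"
proof -
  have "\<omega> ((T ^^ i) v) ((T ^^ j) v) = \<omega> v ((T ^^ (i + j)) v)"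
    by (simp add: T_power_selfadjoint funpow_add)
  moreover have "\<omega> v ((T ^^ (i + j)) v) = - \<omega> v ((T ^^ (i + j)) v)"
    using T_power_selfadjoint[of "i + j" v v] form_skew[of "(T ^^ (i + j)) v" v] by simp
  then have "2 * \<omega> v ((T ^^ (i + j)) v) = 0"
    by (simp only: mult_2) (metis add.right_inverse)
  then have "\<omega> v ((T ^^ (i + j)) v) = 0" using two_neq_0 by simp
  ultimately show ?thesis by simp
qed

lemma cyclic_span_isotropic:
  assumes "u \<in> span (range (\<lambda>i. (T ^^ i) v))" "u' \<in> span (range (\<lambda>i. (T ^^ i) v))"
  shows "\<omega> u u' = 0"
  using assms(1)
  by (rule form_span_left_zero)
    (use assms(2) in \<open>auto intro!: form_span_right_zero[OF assms(2)] simp: cyclic_isotropic\<close>)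

text \<open>Splitting off the last vector in an induction on \<open>d\<close> gives coefficients
  indexed by position, even when \<open>f\<close> is not injective.\<close>

lemma span_image_lessThan_sum:
  assumes "v \<in> span (f ` {..<d :: nat})"
  shows "\<exists>a. v = (\<Sum>i<d. a i *s f i)"
  using assms
proof (induction d arbitrary: v)
  case (Suc d)
  then obtain c where "v - c *s f d \<in> span (f ` {..<d})"
    by (auto simp: lessThan_Suc span_breakdown_eq)
  then obtain a where a: "v - c *s f d = (\<Sum>i<d. a i *s f i)"
    using Suc.IH by blast
  show ?case
    by (rule exI[of _ "a(d := c)"]) (use a in \<open>simp add: algebra_simps\<close>)
qed auto

text \<open>Nondegeneracy on \<open>W\<close> lets vectors of \<open>W\<close> realise prescribed
  values of functionals. The induction removes one vector \<open>a\<close> of \<open>U\<close>: if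
  \<open>a\<close> depends on the others it is annihilated anyway, otherwise two solutions for
  smaller sets are combined.\<close>

lemma separating_vector:
  assumes "finite U" "subspace W" "U \<subseteq> W" "u \<in> W" "u \<notin> span U"
    and nondegenerate: "\<And>v. v \<in> W \<Longrightarrow> v \<noteq> 0 \<Longrightarrow> \<exists>w\<in>W. \<omega> v w \<noteq> 0"
  shows "\<exists>w\<in>W. (\<forall>v\<in>U. \<omega> v w = 0) \<and> \<omega> u w = 1"
  using assms(1,3,4,5)
proof (induction U arbitrary: u rule: finite_induct)
  case empty
  then obtain w where "w \<in> W" "\<omega> u w \<noteq> 0" using nondegenerate[of u] by auto
  then show ?case
    by (intro bexI[of _ "inverse (\<omega> u w) *s w"])
      (auto simp: form_linear subspace_scale[OF assms(2)])
next
  case (insert a U)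
  have u: "u - c *s a \<notin> span U" for c
    using insert.prems(3) by (auto simp: span_breakdown_eq)
  show ?case
  proof (cases "a \<in> span U")
    case True
    obtain w where w: "w \<in> W" "\<forall>v\<in>U. \<omega> v w = 0" "\<omega> u w = 1"
      using insert.IH[of u] insert.prems u[of 0] by auto
    have "\<omega> a w = 0" using form_span_left_zero[OF True] w(2) by blast
    then show ?thesis using w by auto
  next
    case False
    then obtain w0 where w0: "w0 \<in> W" "\<forall>v\<in>U. \<omega> v w0 = 0" "\<omega> a w0 = 1"
      using insert.IH[of a] insert.prems by auto
    \<comment> \<open>The correction gives \<open>\<omega> u' w0 = 0\<close>. Hence
      \<open>w1 - \<omega> a w1 *s w0\<close> annihilates \<open>a\<close> and still pairs to 1 with
      \<open>u\<close>.\<close>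
    define u' where "u' = u - \<omega> u w0 *s a"
    have "u' \<in> W" unfolding u'_def using insert.prems
      by (intro subspace_diff[OF assms(2)] subspace_scale[OF assms(2)]) auto
    then obtain w1 where w1: "w1 \<in> W" "\<forall>v\<in>U. \<omega> v w1 = 0" "\<omega> u' w1 = 1"
      using insert.IH[of u'] insert.prems u[of "\<omega> u w0"] by (auto simp: u'_def)
    have "\<omega> u w1 - \<omega> u w0 * \<omega> a w1 = 1"
      using w1(3) by (simp add: u'_def form_linear)
    then show ?thesis using w0 w1
      by (intro bexI[of _ "w1 - \<omega> a w1 *s w0"])
        (auto simp: form_linear mult.commute intro!: subspace_diff[OF assms(2)] subspace_scale[OF assms(2)])
  qed
qed

section \<open>Krylov subspaces\<close>

definition krylov :: "'v \<Rightarrow> nat \<Rightarrow> 'v set" where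
  "krylov v d = span ((\<lambda>i. (T ^^ i) v) ` {..<d})"

text \<open>For \<open>v\<close> in \<open>span E\<close> this is the degree of the minimal
  polynomial of \<open>v\<close> with respect to \<open>T\<close>, that is, the dimension of the
  cyclic subspace of \<open>v\<close>. Outside \<open>span E\<close> such a \<open>d\<close> need
  not exist.\<close>

definition krylov_dim :: "'v \<Rightarrow> nat" where
  "krylov_dim v = (LEAST d. (T ^^ d) v \<in> krylov v d)"

text \<open>Each new power lies outside the span of its predecessors. The cardinality is recorded
  because an image set could hide repeated vectors.\<close>

lemma krylov_independent:
  assumes "\<And>i. i < d \<Longrightarrow> (T ^^ i) v \<notin> krylov v i"
  shows "independent ((\<lambda>i. (T ^^ i) v) ` {..<d}) \<and> card ((\<lambda>i. (T ^^ i) v) ` {..<d}) = d"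
  using assms
proof (induction d)
  case (Suc d)
  have IH: "independent ((\<lambda>i. (T ^^ i) v) ` {..<d})" "card ((\<lambda>i. (T ^^ i) v) ` {..<d}) = d"
    using Suc by auto
  have notin: "(T ^^ d) v \<notin> span ((\<lambda>i. (T ^^ i) v) ` {..<d})"
    using Suc.prems[of d] by (simp add: krylov_def)
  then have "(T ^^ d) v \<notin> (\<lambda>i. (T ^^ i) v) ` {..<d}"
    by (rule contrapos_nn) (rule span_base)
  then show ?case using IH notin by (simp add: lessThan_Suc independent_insertI)
qed (auto simp: independent_empty)

text \<open>Otherwise the first \<open>Suc (card E)\<close> powers would be independent inside
  \<open>span E\<close>.\<close>

lemma krylov_dim_le_card:
  assumes "v \<in> span E"
  shows "krylov_dim v \<le> card E" "(T ^^ krylov_dim v) v \<in> krylov v (krylov_dim v)"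
proof -
  have "\<exists>d\<le>card E. (T ^^ d) v \<in> krylov v d"
  proof (rule ccontr)
    assume "\<not> ?thesis"
    then have "\<And>i. i < Suc (card E) \<Longrightarrow> (T ^^ i) v \<notin> krylov v i" by auto
    from krylov_independent[OF this]
    have "card ((\<lambda>i. (T ^^ i) v) ` {..<Suc (card E)}) \<le> card E"
      and card: "card ((\<lambda>i. (T ^^ i) v) ` {..<Suc (card E)}) = Suc (card E)"
      using independent_span_bound[OF finite_E] T_power_closed[OF assms] by blast+
    then show False by linarith
  qed
  then show "krylov_dim v \<le> card E" "(T ^^ krylov_dim v) v \<in> krylov v (krylov_dim v)"
    unfolding krylov_dim_def by (auto intro: LeastI Least_le order.trans)
qed

lemma krylov_mono: "d \<le> e \<Longrightarrow> krylov v d \<subseteq> krylov v e"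
  unfolding krylov_def by (intro span_mono image_mono) auto

text \<open>The relation for \<open>(T ^^ d) v\<close> makes \<open>krylov v d\<close> invariant
  under \<open>T\<close>: only the last generator could leave the span.\<close>

lemma krylov_absorbs:
  assumes "(T ^^ d) v \<in> krylov v d"
  shows "(T ^^ m) v \<in> krylov v d"
proof (induction m)
  case 0
  \<comment> \<open>For \<open>d = 0\<close> the assumption itself says that \<open>v\<close> lies
    in the span of the empty set; for \<open>d > 0\<close>, \<open>v\<close> is a generator.\<close>
  show ?case
    using assms span_base[of "(T ^^ 0) v" "(\<lambda>i. (T ^^ i) v) ` {..<d}"] unfolding krylov_def
    by (cases "d = 0") (force simp: image_iff)+
next
  case (Suc m)
  show ?case
    using Suc.IH unfolding krylov_def funpow.simps o_apply
  proof (rule T_span)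
    fix s assume "s \<in> (\<lambda>i. (T ^^ i) v) ` {..<d}"
    then obtain i where i: "i < d" "s = (T ^^ i) v" by auto
    show "T s \<in> span ((\<lambda>i. (T ^^ i) v) ` {..<d})"
    proof (cases "Suc i = d")
      case True
      then show ?thesis using assms i by (auto simp: krylov_def)
    next
      case False
      then have "T s = (T ^^ Suc i) v" "Suc i \<in> {..<d}" using i by auto
      then show ?thesis using span_base imageI by metis
    qed
  qed
qed

section \<open>Hyperbolic families: dual bases of two invariant isotropic subspaces\<close>

definition hyperbolic :: "nat \<Rightarrow> (nat \<Rightarrow> 'v) \<Rightarrow> (nat \<Rightarrow> 'v) \<Rightarrow> bool" where
  "hyperbolic k x y \<longleftrightarrow>
     (\<forall>i<k. x i \<in> span E \<and> y i \<in> span E \<and>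
        T (x i) \<in> span (x ` {..<k}) \<and> T (y i) \<in> span (y ` {..<k}) \<and>
        (\<forall>j<k. \<omega> (x i) (x j) = 0 \<and> \<omega> (y i) (y j) = 0 \<and> \<omega> (x i) (y j) = of_bool (i = j)))"

definition perp :: "nat \<Rightarrow> (nat \<Rightarrow> 'v) \<Rightarrow> (nat \<Rightarrow> 'v) \<Rightarrow> 'v set" where
  "perp k x y = {v \<in> span E. \<forall>i<k. \<omega> (x i) v = 0 \<and> \<omega> (y i) v = 0}"

lemma hyperbolicD:
  assumes "hyperbolic k x y" "i < k"
  shows "x i \<in> span E" "y i \<in> span E" "T (x i) \<in> span (x ` {..<k})" "T (y i) \<in> span (y ` {..<k})"
    "j < k \<Longrightarrow> \<omega> (x i) (x j) = 0" "j < k \<Longrightarrow> \<omega> (y i) (y j) = 0"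
    "j < k \<Longrightarrow> \<omega> (x i) (y j) = of_bool (i = j)" "j < k \<Longrightarrow> \<omega> (y i) (x j) = - of_bool (i = j)"
  using assms form_skew[of "y i" "x j"] unfolding hyperbolic_def by auto

text \<open>Duality forces independence: \<open>y i\<close> pairs nontrivially with
  \<open>x i\<close> and annihilates the other members, and vice versa. So there are
  \<open>2 * k\<close> independent vectors in \<open>span E\<close>.\<close>

lemma hyperbolic_card_le:
  assumes h: "hyperbolic k x y"
  shows "2 * k \<le> card E"
proof -
  note D = hyperbolicD[OF h]
  let ?S = "x ` {..<k} \<union> y ` {..<k}"
  have "independent ?S"
    unfolding dependent_def
  proof safe
    fix i assume i: "i < k" and "x i \<in> span (?S - {x i})"
    from this(2) have "\<omega> (x i) (y i) = 0"
      by (rule form_span_left_zero) (use D i in auto)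
    then show False using D i by simp
  next
    fix i assume i: "i < k" and "y i \<in> span (?S - {y i})"
    from this(2) have "\<omega> (y i) (x i) = 0"
      by (rule form_span_left_zero) (use D i in auto)
    then show False using D i by simp
  qed
  moreover have "?S \<subseteq> span E" using D by auto
  ultimately have "card ?S \<le> card E" using independent_span_bound[OF finite_E] by blast
  moreover have "inj_on x {..<k}"
  proof (rule inj_onI)
    fix i j assume "i \<in> {..<k}" "j \<in> {..<k}" "x i = x j"
    then show "i = j" using D(7)[of i i] D(7)[of j i] by (cases "i = j") auto
  qed
  moreover have "inj_on y {..<k}"
  proof (rule inj_onI)
    fix i j assume "i \<in> {..<k}" "j \<in> {..<k}" "y i = y j"
    then show "i = j" using D(7)[of i i] D(7)[of i j] by (cases "i = j") auto
  qed
  moreover have "x i \<noteq> y j" if "i < k" "j < k" for i j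
    using D(7)[of i i] D(6)[of j i] that by auto
  then have "x ` {..<k} \<inter> y ` {..<k} = {}" by blast
  ultimately show ?thesis by (simp add: card_Un_disjoint card_image)
qed

section \<open>Orthogonal complements of hyperbolic families\<close>

lemma subspace_perp: "subspace (perp k x y)"
  unfolding subspace_def perp_def by (auto simp: form_linear span_zero intro: span_add span_scale)

text \<open>Self-adjointness moves \<open>T\<close> onto \<open>x i\<close> and \<open>y i\<close>,
  whose images stay in spans orthogonal to \<open>v\<close>.\<close>

lemma T_perp:
  assumes h: "hyperbolic k x y" and v: "v \<in> perp k x y"
  shows "T v \<in> perp k x y"
proof -
  have "\<omega> (T (x i)) v = 0" "\<omega> (T (y i)) v = 0" if "i < k" for i
    using form_span_left_zero[OF hyperbolicD(3)[OF h that]]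
      form_span_left_zero[OF hyperbolicD(4)[OF h that]] v by (auto simp: perp_def)
  then show ?thesis using v by (auto simp: perp_def T_selfadjoint intro: T_closed)
qed

lemma perp_projection:
  assumes h: "hyperbolic k x y" and u: "u \<in> span E"
  shows "\<exists>p\<in>span (x ` {..<k} \<union> y ` {..<k}). u - p \<in> perp k x y"
proof -
  note D = hyperbolicD[OF h]
  \<comment> \<open>Expansion in dual bases: the coefficient of \<open>y i\<close> comes from
    pairing with \<open>x i\<close> and conversely. The minus sign compensates
    \<open>\<omega> (y i) (x i) = - 1\<close>.\<close>
  define p where "p = (\<Sum>i<k. \<omega> (x i) u *s y i - \<omega> (y i) u *s x i)"
  have "p \<in> span E" unfolding p_def using D
    by (intro span_sum span_diff span_scale) auto
  moreover have "\<omega> (x i) p = \<omega> (x i) u" "\<omega> (y i) p = \<omega> (y i) u" if "i < k" for i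
  proof -
    have "\<omega> (x i) p = (\<Sum>l<k. if l = i then \<omega> (x l) u else 0)"
      using that unfolding p_def form_linear by (intro sum.cong) (auto simp: D)
    then show "\<omega> (x i) p = \<omega> (x i) u" using that by simp
    have "\<omega> (y i) p = (\<Sum>l<k. if l = i then \<omega> (y l) u else 0)"
      using that unfolding p_def form_linear by (intro sum.cong) (auto simp: D)
    then show "\<omega> (y i) p = \<omega> (y i) u" using that by simp
  qed
  moreover have "p \<in> span (x ` {..<k} \<union> y ` {..<k})" unfolding p_def
    by (intro span_sum span_diff span_scale span_base) auto
  ultimately show ?thesis using u
    by (intro bexI[of _ p]) (auto simp: perp_def form_linear intro: span_diff)
qed

text \<open>A vector of \<open>span E\<close> that detects \<open>v\<close> can be projected into
  the complement without changing its pairing with \<open>v\<close>, since \<open>v\<close> is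
  orthogonal to the part removed.\<close>

lemma perp_nondegenerate:
  assumes h: "hyperbolic k x y" and v: "v \<in> perp k x y" "v \<noteq> 0"
  shows "\<exists>w\<in>perp k x y. \<omega> v w \<noteq> 0"
proof -
  obtain u where u: "u \<in> span E" "\<omega> v u \<noteq> 0"
    using form_nondegenerate v by (auto simp: perp_def)
  obtain p where p: "p \<in> span (x ` {..<k} \<union> y ` {..<k})" "u - p \<in> perp k x y"
    using perp_projection[OF h u(1)] by blast
  have "\<omega> v s = 0" if "s \<in> x ` {..<k} \<union> y ` {..<k}" for s
    using v(1) that form_skew[of v s] by (auto simp: perp_def)
  then have "\<omega> v p = 0" using form_span_right_zero[OF p(1)] by blast
  then show ?thesis using u p(2) by (intro bexI[of _ "u - p"]) (auto simp: form_linear)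
qed

text \<open>With a zero complement the projection would put all of \<open>E\<close> into the span of
  at most \<open>2 * k\<close> vectors.\<close>

lemma perp_nontrivial:
  assumes h: "hyperbolic k x y" and k: "2 * k < card E"
  shows "\<exists>v\<in>perp k x y. v \<noteq> 0"
proof (rule ccontr)
  assume *: "\<not> ?thesis"
  let ?S = "x ` {..<k} \<union> y ` {..<k}"
  have "u \<in> span ?S" if u: "u \<in> E" for u
  proof -
    obtain p where "p \<in> span ?S" "u - p \<in> perp k x y"
      using perp_projection[OF h, of u] span_base[OF u] by blast
    then show ?thesis using * by (metis eq_iff_diff_eq_0)
  qed
  then have "card E \<le> card ?S"
    using independent_span_bound[of ?S E] independent_E by auto
  also have "\<dots> \<le> card (x ` {..<k}) + card (y ` {..<k})" by (rule card_Un_le)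
  also have "\<dots> \<le> k + k"
    using card_image_le[of "{..<k}" x] card_image_le[of "{..<k}" y] by auto
  finally show False using k by simp
qed

text \<open>The second family is placed after the first, with indices shifted by \<open>k\<close>.
  Mixed pairings vanish by orthogonality, and enlarging the spans preserves invariance.\<close>

lemma hyperbolic_append:
  assumes h: "hyperbolic k x y" and h': "hyperbolic d x' y'"
    and perp: "\<And>i. i < d \<Longrightarrow> x' i \<in> perp k x y \<and> y' i \<in> perp k x y"
  shows "hyperbolic (k + d) (\<lambda>i. if i < k then x i else x' (i - k)) (\<lambda>i. if i < k then y i else y' (i - k))"
proof -
  note D = hyperbolicD[OF h] and D' = hyperbolicD[OF h']
  have cross: "\<omega> (x i) (x' j) = 0" "\<omega> (x i) (y' j) = 0" "\<omega> (y i) (y' j) = 0"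
    "\<omega> (x' j) (x i) = 0" "\<omega> (x' j) (y i) = 0" "\<omega> (y' j) (y i) = 0" if "i < k" "j < d" for i j
    using perp[OF that(2)] that(1) form_skew[of "x' j"] form_skew[of "y' j"] by (auto simp: perp_def)
  have img: "(\<lambda>i. if i < k then f i else f' (i - k)) ` {..<k + d} = f ` {..<k} \<union> f' ` {..<d}"
    for f f' :: "nat \<Rightarrow> 'v"
  proof -
    have "{..<k + d} = {..<k} \<union> (\<lambda>i. i + k) ` {..<d}"
    proof (rule Set.set_eqI)
      fix i show "i \<in> {..<k + d} \<longleftrightarrow> i \<in> {..<k} \<union> (\<lambda>i. i + k) ` {..<d}"
        by (cases "i < k") (auto simp: image_iff intro!: bexI[of _ "i - k"])
    qed
    moreover have "(\<lambda>i. if i < k then f i else f' (i - k)) ` {..<k} = f ` {..<k}"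
      by (intro image_cong) auto
    moreover have "(\<lambda>i. if i < k then f i else f' (i - k)) ` (\<lambda>i. i + k) ` {..<d} = f' ` {..<d}"
      unfolding image_image by (intro image_cong) auto
    ultimately show ?thesis by (simp only: image_Un)
  qed
  have sub: "span (f ` {..<k}) \<subseteq> span (f ` {..<k} \<union> f' ` {..<d})"
    "span (f' ` {..<d}) \<subseteq> span (f ` {..<k} \<union> f' ` {..<d})" for f f' :: "nat \<Rightarrow> 'v"
    by (intro span_mono; blast)+
  let ?x = "\<lambda>i. if i < k then x i else x' (i - k)"
  let ?y = "\<lambda>i. if i < k then y i else y' (i - k)"
  have "?x i \<in> span E \<and> ?y i \<in> span E \<and>
      T (?x i) \<in> span (?x ` {..<k + d}) \<and> T (?y i) \<in> span (?y ` {..<k + d})"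
    if "i < k + d" for i
    unfolding img using D(1-4)[of i] D'(1-4)[of "i - k"] that
      subsetD[OF sub(1)[of x x']] subsetD[OF sub(1)[of y y']]
      subsetD[OF sub(2)[of x' x]] subsetD[OF sub(2)[of y' y]]
    by (cases "i < k") auto
  moreover have "\<omega> (?x i) (?x j) = 0 \<and> \<omega> (?y i) (?y j) = 0 \<and> \<omega> (?x i) (?y j) = of_bool (i = j)"
    if ij: "i < k + d" "j < k + d" for i j
  proof -
    consider "i < k" "j < k" | "i < k" "\<not> j < k" "j - k < d" | "\<not> i < k" "i - k < d" "j < k"
      | "\<not> i < k" "i - k < d" "\<not> j < k" "j - k < d"
      using ij by linarith
    then show ?thesis
    proof cases
      case 1
      then show ?thesis using D(5-7)[of i j] by simp
    next
      case 2
      then show ?thesis using cross(1,2,3)[of i "j - k"] by simp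
    next
      case 3
      then show ?thesis using cross(4,5,6)[of j "i - k"] by auto
    next
      case 4
      then show ?thesis using D'(5-7)[of "i - k" "j - k"] by auto
    qed
  qed
  ultimately show ?thesis unfolding hyperbolic_def by blast
qed

text \<open>The inductive building block, meant for \<open>W = perp k x y\<close>: \<open>x\<close>
  is the longest Krylov chain in \<open>W\<close>, and \<open>y\<close> is a dual basis of the
  cyclic space of a second vector of \<open>W\<close>.\<close>

lemma hyperbolic_in_subspace:
  assumes W: "subspace W" "W \<subseteq> span E" and T_W: "\<And>v. v \<in> W \<Longrightarrow> T v \<in> W"
    and nontrivial: "\<exists>v\<in>W. v \<noteq> 0"
    and nondegenerate: "\<And>v. v \<in> W \<Longrightarrow> v \<noteq> 0 \<Longrightarrow> \<exists>w\<in>W. \<omega> v w \<noteq> 0"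
  shows "\<exists>d x y. d > 0 \<and> hyperbolic d x y \<and> (\<forall>i<d. x i \<in> W \<and> y i \<in> W)"
proof -
  obtain v0 where v0: "v0 \<in> W" "v0 \<noteq> 0" using nontrivial by blast
  have "\<exists>v. v \<in> W \<and> (\<forall>w. w \<in> W \<longrightarrow> krylov_dim w \<le> krylov_dim v)"
    by (rule ex_has_greatest_nat[of _ v0 _ "Suc (card E)"])
      (use v0 W krylov_dim_le_card in \<open>auto simp: less_Suc_eq_le\<close>)
  then obtain v where v: "v \<in> W" "\<And>w. w \<in> W \<Longrightarrow> krylov_dim w \<le> krylov_dim v" by blast
  define d where "d = krylov_dim v"
  have "krylov_dim v0 \<noteq> 0"
  proof
    assume "krylov_dim v0 = 0"
    then have "v0 \<in> krylov v0 0" using krylov_dim_le_card(2)[of v0] v0 W by auto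
    then show False using v0 by (simp add: krylov_def)
  qed
  then have d: "d > 0" using v(2)[OF v0(1)] by (simp add: d_def)
  have pow_W: "(T ^^ i) u \<in> W" if "u \<in> W" for i u
    using that by (induction i) (auto intro: T_W)
  have "(T ^^ d) v \<in> krylov v d" using krylov_dim_le_card(2)[of v] v W by (auto simp: d_def)
  then obtain a where a: "(T ^^ d) v = (\<Sum>i<d. a i *s (T ^^ i) v)"
    using span_image_lessThan_sum unfolding krylov_def by blast
  \<comment> \<open>Minimality of \<open>d\<close> keeps the last power independent of the earlier
    ones. The resulting \<open>w\<close> reads off the coefficient of
    \<open>(T ^^ (d - 1)) v\<close> on \<open>krylov v d\<close>.\<close>
  have "(T ^^ (d - 1)) v \<notin> krylov v (d - 1)"
    using d not_less_Least[of "d - 1" "\<lambda>d. (T ^^ d) v \<in> krylov v d"]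
    by (simp add: d_def krylov_dim_def)
  moreover have "(\<lambda>i. (T ^^ i) v) ` {..<d - 1} \<subseteq> W" using pow_W[OF v(1)] by blast
  ultimately obtain w where w: "w \<in> W" "\<And>i. i < d - 1 \<Longrightarrow> \<omega> ((T ^^ i) v) w = 0"
      "\<omega> ((T ^^ (d - 1)) v) w = 1"
    using separating_vector[of "(\<lambda>i. (T ^^ i) v) ` {..<d - 1}" W "(T ^^ (d - 1)) v"]
      W pow_W[OF v(1)] nondegenerate
    unfolding krylov_def by auto
  text \<open>The Horner scheme for the relation \<open>T\<^sup>d v = \<Sum> a\<^sub>i T\<^sup>i v\<close>, applied to \<open>w\<close>,
    produces the basis dual to \<open>v, T v, \<dots>\<close> in reverse order.\<close>
  define z where "z = rec_nat w (\<lambda>j u. T u - a (d - 1 - j) *s w)"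
  have z_0: "z 0 = w" and z_Suc: "\<And>j. z (Suc j) = T (z j) - a (d - 1 - j) *s w"
    by (simp_all add: z_def)
  \<comment> \<open>The case \<open>j = d\<close> is included on purpose: there the right-hand side
    is 0 for every \<open>i < d\<close>, so \<open>z d\<close> is orthogonal to all of
    \<open>krylov v d\<close>.\<close>
  have pairing: "\<omega> ((T ^^ i) v) (z j) = of_bool (i + j = d - 1)" if "j \<le> d" "i < d" for i j
    using that
  proof (induction j arbitrary: i)
    case 0
    then show ?case using w by (cases "i = d - 1") (auto simp: z_0)
  next
    case (Suc j)
    have *: "\<omega> ((T ^^ i) v) (z (Suc j)) =
        \<omega> ((T ^^ Suc i) v) (z j) - a (d - 1 - j) * \<omega> ((T ^^ i) v) w"
      by (simp add: z_Suc form_linear T_selfadjoint)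
    show ?case
    proof (cases "i = d - 1")
      case True
      \<comment> \<open>The relation for \<open>(T ^^ d) v\<close> contributes exactly
        \<open>a (d - 1 - j)\<close>, which the correction term in \<open>z (Suc j)\<close> cancels.
        For smaller \<open>i\<close> the correction vanishes and the index merely shifts.\<close>
      then have "(T ^^ Suc i) v = (\<Sum>i<d. a i *s (T ^^ i) v)" using a d by (metis Suc_diff_1)
      then have "\<omega> ((T ^^ Suc i) v) (z j) = (\<Sum>l<d. a l * \<omega> ((T ^^ l) v) (z j))"
        by (simp only: form_linear)
      also have "\<dots> = (\<Sum>l<d. if l = d - 1 - j then a l else 0)"
        using Suc by (intro sum.cong) auto
      also have "\<dots> = a (d - 1 - j)" using d by (simp add: sum.delta)
      finally show ?thesis using * True w by simp
    next
      case False
      then show ?thesis using * Suc.IH[of "Suc i"] Suc.prems w(2)[of i] by simp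
    qed
  qed
  have T_z: "T (z j) = z (Suc j) + a (d - 1 - j) *s w" for j by (simp add: z_Suc)
  have z_W: "z j \<in> W" for j
    by (induction j) (auto simp: z_0 z_Suc w intro!: subspace_diff subspace_scale W T_W)
  have w_cyclic: "w \<in> span (range (\<lambda>i. (T ^^ i) w))"
    using span_base[OF rangeI[of "\<lambda>i. (T ^^ i) w" 0]] by simp
  have z_cyclic: "z j \<in> span (range (\<lambda>i. (T ^^ i) w))" for j
  proof (induction j)
    case 0
    show ?case using w_cyclic by (simp add: z_0)
  next
    case (Suc j)
    have "T (z j) \<in> span (range (\<lambda>i. (T ^^ i) w))"
    proof (rule T_span[OF Suc])
      fix s assume "s \<in> range (\<lambda>i. (T ^^ i) w)"
      then obtain i where "s = (T ^^ i) w" by auto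
      then have "T s = (T ^^ Suc i) w" by simp
      then show "T s \<in> span (range (\<lambda>i. (T ^^ i) w))" using span_base rangeI by metis
    qed
    then show ?case unfolding z_Suc using w_cyclic by (intro span_diff span_scale)
  qed
  \<comment> \<open>Up to a multiple of \<open>w = z 0\<close>, \<open>T\<close> sends
    \<open>z j\<close> to \<open>z (Suc j)\<close>, so the change from the powers of
    \<open>T\<close> on \<open>w\<close> to the \<open>z j\<close> is triangular.\<close>
  have pow_z: "(T ^^ l) w \<in> span (z ` {..l})" for l
  proof (induction l)
    case 0
    show ?case by (auto simp: z_0 intro: span_base)
  next
    case (Suc l)
    have "T ((T ^^ l) w) \<in> span (z ` {..Suc l})"
    proof (rule T_span[OF Suc])
      fix s assume "s \<in> z ` {..l}"
      then obtain j where j: "j \<le> l" "s = z j" by auto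
      have "z (Suc j) \<in> span (z ` {..Suc l})" "z 0 \<in> span (z ` {..Suc l})"
        using j by (auto intro!: span_base)
      then show "T s \<in> span (z ` {..Suc l})"
        unfolding j(2) T_z by (auto simp: z_0 intro!: span_add span_scale)
    qed
    then show ?case by simp
  qed
  \<comment> \<open>This is where the maximal choice of \<open>v\<close> enters:
    \<open>krylov_dim w \<le> d\<close>, hence the first \<open>d\<close> powers already span the
    cyclic space of \<open>w\<close>.\<close>
  have cyclic_z: "(T ^^ l) w \<in> span (z ` {..<d})" for l
  proof -
    have "(T ^^ l) w \<in> krylov w (krylov_dim w)"
      using krylov_absorbs krylov_dim_le_card(2) w(1) W(2) by blast
    then have "(T ^^ l) w \<in> krylov w d" using krylov_mono v(2)[OF w(1)] by (auto simp: d_def)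
    moreover have "krylov w d \<subseteq> span (z ` {..<d})"
      unfolding krylov_def
    proof (rule span_minimal)
      have "span (z ` {..i}) \<subseteq> span (z ` {..<d})" if "i < d" for i
        using that by (intro span_mono image_mono) auto
      then show "(\<lambda>i. (T ^^ i) w) ` {..<d} \<subseteq> span (z ` {..<d})" using pow_z by blast
    qed auto
    ultimately show ?thesis by blast
  qed
  \<comment> \<open>\<open>z d\<close> is a combination of the earlier \<open>z j\<close>, which are
    dual to the powers of \<open>T\<close> on \<open>v\<close>, but it is orthogonal to all these
    powers. Hence its coefficients vanish, and the span of \<open>z 0\<close>, ...,
    \<open>z (d - 1)\<close> is invariant under \<open>T\<close>.\<close>
  have z_d: "z d = 0"
  proof -
    have "span (range (\<lambda>i. (T ^^ i) w)) \<subseteq> span (z ` {..<d})"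
      by (rule span_minimal) (use cyclic_z in auto)
    then obtain c where c: "z d = (\<Sum>j<d. c j *s z j)"
      using z_cyclic span_image_lessThan_sum by blast
    have "c j = 0" if "j < d" for j
    proof -
      have "0 = \<omega> ((T ^^ (d - 1 - j)) v) (z d)" using pairing[of d "d - 1 - j"] d by simp
      also have "\<dots> = (\<Sum>l<d. c l * \<omega> ((T ^^ (d - 1 - j)) v) (z l))" by (simp add: c form_linear)
      also have "\<dots> = (\<Sum>l<d. if l = j then c l else 0)"
        using that by (intro sum.cong refl) (auto simp: pairing)
      finally show ?thesis using that by simp
    qed
    then show ?thesis using c by simp
  qed
  define x where "x = (\<lambda>i. (T ^^ i) v)"
  \<comment> \<open>Reversal turns the antidiagonal pairing \<open>i + j = d - 1\<close> into
    \<open>i = j\<close>.\<close>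
  define y where "y = (\<lambda>i. z (d - 1 - i))"
  have y_image: "y ` {..<d} = z ` {..<d}"
  proof -
    have "(\<lambda>i. d - 1 - i) ` {..<d} = {..<d}"
    proof
      show "{..<d} \<subseteq> (\<lambda>i. d - 1 - i) ` {..<d}"
      proof
        fix i assume "i \<in> {..<d}"
        then show "i \<in> (\<lambda>i. d - 1 - i) ` {..<d}" by (intro image_eqI[of _ _ "d - 1 - i"]) auto
      qed
    qed (use d in auto)
    then show ?thesis by (metis (no_types, lifting) y_def image_cong image_image)
  qed
  have T_y: "T (z j) \<in> span (z ` {..<d})" if "j < d" for j
  proof -
    have "z (Suc j) \<in> span (z ` {..<d})"
      using that by (cases "Suc j = d") (auto simp: z_d span_zero intro: span_base)
    moreover have "z 0 \<in> span (z ` {..<d})" using d by (auto intro: span_base)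
    ultimately show ?thesis by (auto simp: T_z z_0 intro!: span_add span_scale)
  qed
  have T_x: "T (x i) \<in> span (x ` {..<d})" if "i < d" for i
    using krylov_absorbs[of d v "Suc i"] \<open>(T ^^ d) v \<in> krylov v d\<close> by (simp add: krylov_def x_def)
  have "hyperbolic d x y"
    unfolding hyperbolic_def y_image
    using W z_W T_x T_y cyclic_isotropic cyclic_span_isotropic[OF z_cyclic z_cyclic] pow_W[OF v(1)] pairing
    by (auto simp: x_def y_def)
  moreover have "x i \<in> W \<and> y i \<in> W" for i using z_W pow_W[OF v(1)] by (simp add: x_def y_def)
  ultimately show ?thesis using d by blast
qed

text \<open>A longest hyperbolic family has \<open>k = n\<close>, since otherwise its nonzero
  complement would yield an extension. The same \<open>b\<close> occurs, transposed, in both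
  expansions because \<open>T\<close> is self-adjoint and the bases are dual.\<close>

theorem hyperbolic_basis:
  assumes "card E = 2 * n"
  shows "\<exists>x y b. (\<forall>i<n. T (x i) = (\<Sum>j<n. b j i *s x j) \<and> T (y i) = (\<Sum>j<n. b i j *s y j) \<and>
    (\<forall>j<n. \<omega> (x i) (x j) = 0 \<and> \<omega> (y i) (y j) = 0 \<and> \<omega> (x i) (y j) = of_bool (i = j)))"
proof -
  have "\<exists>k. (\<exists>x y. hyperbolic k x y) \<and> (\<forall>l. (\<exists>x y. hyperbolic l x y) \<longrightarrow> l \<le> k)"
  proof (rule ex_has_greatest_nat[of _ 0 "\<lambda>k. k" "Suc n"])
    show "\<exists>x y. hyperbolic 0 x y" by (simp add: hyperbolic_def)
    show "\<forall>k. (\<exists>x y. hyperbolic k x y) \<longrightarrow> k < Suc n"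
      using hyperbolic_card_le assms by (metis less_Suc_eq_le mult_le_cancel1 pos2)
  qed
  then obtain k x y where h: "hyperbolic k x y" and max: "\<And>l x y. hyperbolic l x y \<Longrightarrow> l \<le> k"
    by blast
  have "k = n"
  proof (rule ccontr)
    assume "k \<noteq> n"
    then have "2 * k < card E" using hyperbolic_card_le[OF h] assms by simp
    then obtain d x' y' where "d > 0" "hyperbolic d x' y'"
        "\<forall>i<d. x' i \<in> perp k x y \<and> y' i \<in> perp k x y"
      using hyperbolic_in_subspace[OF subspace_perp _ T_perp[OF h] perp_nontrivial[OF h]
          perp_nondegenerate[OF h]] by (auto simp: perp_def)
    then show False using max[OF hyperbolic_append[OF h]] by fastforce
  qed
  note D = hyperbolicD[OF h[unfolded \<open>k = n\<close>]]
  have "\<forall>i. \<exists>b. i < n \<longrightarrow> T (x i) = (\<Sum>j<n. b j *s x j)"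
    "\<forall>i. \<exists>c. i < n \<longrightarrow> T (y i) = (\<Sum>j<n. c j *s y j)"
    using span_image_lessThan_sum D(3,4) by blast+
  then obtain b c where b: "\<And>i. i < n \<Longrightarrow> T (x i) = (\<Sum>j<n. b i j *s x j)"
    and c: "\<And>i. i < n \<Longrightarrow> T (y i) = (\<Sum>j<n. c i j *s y j)"
    by metis
  \<comment> \<open>Both coefficients are the value of \<open>\<omega> (T (x j)) (y i)\<close>,
    expanded once on each side of the form.\<close>
  have "c i j = b j i" if "i < n" "j < n" for i j
  proof -
    have "\<omega> (T (x j)) (y i) = b j i" using that by (simp add: b form_linear D)
    moreover have "\<omega> (x j) (T (y i)) = c i j" using that by (simp add: c form_linear D)
    ultimately show ?thesis by (simp add: T_selfadjoint)
  qed
  then have "T (y i) = (\<Sum>j<n. b j i *s y j)" if "i < n" for i using c that by simp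
  then show ?thesis using b D
    \<comment> \<open>The indices are swapped so that column \<open>i\<close> of the matrix holds
      the coordinates of \<open>T (x i)\<close>.\<close>
    by (intro exI[of _ x] exI[of _ y] exI[of _ "\<lambda>i j. b j i"]) simp
qed

end

section \<open>Jordan normal form over an arbitrary field\<close>

text \<open>If \<open>a\<close> is not a root of \<open>p\<close>, the factor
  \<open>[:- a, 1:]\<close> divides the cofactor and cancels, leaving \<open>p\<close> as a divisor
  of a shorter product.\<close>

lemma dvd_linear_factors_root:
  fixes p :: "'a :: field poly"
  assumes "p dvd (\<Prod>a\<leftarrow>as. [:- a, 1:])" "degree p > 0"
  shows "\<exists>a. poly p a = 0"
  using assms(1)
proof (induction as)
  case Nil
  then show ?case using assms(2) by (auto simp: poly_dvd_1)
next
  case (Cons a as)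
  from Cons.prems obtain q where q: "[:- a, 1:] * (\<Prod>a\<leftarrow>as. [:- a, 1:]) = p * q"
    unfolding list.map prod_list.Cons by (rule dvdE)
  show ?case
  proof (cases "poly p a = 0")
    case False
    have "poly (p * q) a = 0" unfolding q[symmetric] by simp
    then have "[:- a, 1:] dvd q" using False by (simp add: poly_eq_0_iff_dvd)
    then obtain r where "q = [:- a, 1:] * r" by (elim dvdE)
    then have "[:- a, 1:] * (\<Prod>a\<leftarrow>as. [:- a, 1:]) = [:- a, 1:] * (p * r)"
      using q by (simp only: ac_simps)
    moreover have "[:- a, 1:] \<noteq> 0" by simp
    ultimately have "(\<Prod>a\<leftarrow>as. [:- a, 1:]) = p * r" by (metis mult_left_cancel)
    then show ?thesis using Cons.IH by simp
  qed blast
qed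

text \<open>Steinitz exchange: \<open>v\<close> replaces a unit vector at whose position
  \<open>p\<close> it has a nonzero entry.\<close>

lemma invertible_first_column:
  fixes v :: "'a :: field vec"
  assumes v: "v \<in> carrier_vec n" "v \<noteq> 0\<^sub>v n"
  shows "\<exists>W W'. W \<in> carrier_mat n n \<and> W' \<in> carrier_mat n n \<and>
    W * W' = 1\<^sub>m n \<and> W' * W = 1\<^sub>m n \<and> col W 0 = v"
proof -
  obtain p where p: "p < n" "v $ p \<noteq> 0"
    using v by (metis carrier_vecD eq_vecI index_zero_vec(1) index_zero_vec(2))
  define \<sigma> where "\<sigma> = Transposition.transpose 0 p"
  have \<sigma>: "\<sigma> i < n \<and> \<sigma> (\<sigma> i) = i" if "i < n" for i
    using p that by (auto simp: \<sigma>_def Transposition.transpose_def)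
  \<comment> \<open>As \<open>\<sigma>\<close> swaps 0 and \<open>p\<close>, the columns after the
    first run through all unit vectors except the one at \<open>p\<close>. Row \<open>p\<close> of
    \<open>W *\<^sub>v c = 0\<close> then gives \<open>c $ 0 = 0\<close>, and the other rows give
    the remaining entries.\<close>
  define W where "W = mat n n (\<lambda>(i, j). if j = 0 then v $ i else of_bool (i = \<sigma> j))"
  have W: "W \<in> carrier_mat n n" by (simp add: W_def)
  have "c = 0\<^sub>v n" if c: "c \<in> carrier_vec n" "W *\<^sub>v c = 0\<^sub>v n" for c
  proof -
    have row: "v $ i * c $ 0 + (if i = p then 0 else c $ \<sigma> i) = 0" if i: "i < n" for i
    proof -
      have "0 = (W *\<^sub>v c) $ i" using c i by simp
      also have "\<dots> = (\<Sum>j<n. (if j = 0 then v $ i else of_bool (i = \<sigma> j)) * c $ j)"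
        using c(1) i by (auto simp: scalar_prod_def W_def atLeast0LessThan intro!: sum.cong)
      also have "\<dots> = (\<Sum>j<n. (if j = 0 then v $ i * c $ 0 else 0)
          + (if j = \<sigma> i then if i = p then 0 else c $ \<sigma> i else 0))"
        using \<sigma> i p by (intro sum.cong refl) (auto simp: \<sigma>_def Transposition.transpose_def)
      also have "\<dots> = v $ i * c $ 0 + (if i = p then 0 else c $ \<sigma> i)"
        using \<sigma>[OF i] i p by (simp add: sum.distrib)
      finally show ?thesis by simp
    qed
    have c0: "c $ 0 = 0" using row[OF p(1)] p by simp
    have "c $ j = 0" if j: "j < n" for j
    proof (cases "j = 0")
      case False
      then have "\<sigma> j \<noteq> p" by (auto simp: \<sigma>_def Transposition.transpose_def split: if_splits)
      then show ?thesis using row[of "\<sigma> j"] \<sigma>[OF j] c0 by simp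
    qed (use c0 in simp)
    then show ?thesis using c by (intro eq_vecI) auto
  qed
  then have "det W \<noteq> 0" using det_0_iff_vec_prod_zero_field[OF W] by blast
  from det_non_zero_imp_unit[OF W this, of undefined] obtain W' where
    "W' \<in> carrier_mat n n" "W * W' = 1\<^sub>m n" "W' * W = 1\<^sub>m n"
    by (auto simp: Units_def ring_mat_def)
  moreover have "col W 0 = v" using v p by (intro eq_vecI) (auto simp: W_def)
  ultimately show ?thesis using W by blast
qed

text \<open>Deflation by an eigenvector. The hypothesis is divisibility by a split product, rather
  than equality with one, because it then passes at once to the characteristic polynomial of the
  smaller block.\<close>

lemma similar_upper_triangular:
  fixes A :: "'a :: field mat"
  assumes "A \<in> carrier_mat n n" "char_poly A dvd (\<Prod>a\<leftarrow>as. [:- a, 1:])"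
  shows "\<exists>B. B \<in> carrier_mat n n \<and> upper_triangular B \<and> similar_mat A B"
  using assms
proof (induction n arbitrary: A)
  case 0
  then show ?case by (intro exI[of _ A]) (auto intro: similar_mat_refl)
next
  case (Suc n)
  note A = Suc.prems(1)
  have "degree (char_poly A) > 0" using degree_monic_char_poly[OF A] by simp
  then obtain e where "eigenvalue A e"
    using dvd_linear_factors_root[OF Suc.prems(2)] eigenvalue_root_char_poly[OF A] by blast
  then obtain v where v: "v \<in> carrier_vec (Suc n)" "v \<noteq> 0\<^sub>v (Suc n)" "A *\<^sub>v v = e \<cdot>\<^sub>v v"
    using A by (auto simp: eigenvalue_def eigenvector_def)
  obtain W W' where W: "W \<in> carrier_mat (Suc n) (Suc n)" "W' \<in> carrier_mat (Suc n) (Suc n)"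
    "W * W' = 1\<^sub>m (Suc n)" "W' * W = 1\<^sub>m (Suc n)" "col W 0 = v"
    using invertible_first_column[OF v(1,2)] by blast
  define A' where "A' = W' * A * W"
  have A': "A' \<in> carrier_mat (1 + n) (1 + n)" using W A by (simp add: A'_def)
  have "W * A' * W' = (W * W') * A * (W * W')"
    using W(1,2) A unfolding A'_def by (simp add: assoc_mult_mat[of _ "Suc n" "Suc n" _ "Suc n" _ "Suc n"])
  then have "similar_mat_wit A A' W W'"
    using W A A' by (intro similar_mat_witI[of _ _ "Suc n"]) auto
  then have sim: "similar_mat A A'" by (auto simp: similar_mat_def)
  have col: "col A' 0 = e \<cdot>\<^sub>v unit_vec (Suc n) 0"
  proof -
    have "col A' 0 = W' * A *\<^sub>v col W 0"
      unfolding A'_def using W A by (intro col_mult2[of _ "Suc n" "Suc n" _ "Suc n"]) auto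
    also have "\<dots> = W' *\<^sub>v (A *\<^sub>v v)"
      using W A v by (simp add: assoc_mult_mat_vec[of _ "Suc n" "Suc n" _ "Suc n"])
    also have "\<dots> = e \<cdot>\<^sub>v (W' *\<^sub>v col W 0)"
      using W v by (simp add: mult_mat_vec)
    also have "W' *\<^sub>v col W 0 = col (W' * W) 0"
      using W by (intro col_mult2[symmetric, of _ "Suc n" "Suc n" _ "Suc n"]) auto
    finally show ?thesis using W by simp
  qed
  obtain A1 A2 A0 A3 where split: "split_block A' 1 1 = (A1, A2, A0, A3)"
    by (cases "split_block A' 1 1") auto
  have dims: "dim_row A' = 1 + n" "dim_col A' = 1 + n" using A' by auto
  note block = split_block[OF split dims]
  have entries: "A' $$ (i, 0) = (if i = 0 then e else 0)" if "i < Suc n" for i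
  proof -
    have "A' $$ (i, 0) = col A' 0 $ i" using that dims by simp
    then show ?thesis using that by (simp add: col unit_vec_def)
  qed
  have A0: "A0 = 0\<^sub>m n 1"
    using split dims entries by (auto simp: split_block_def Let_def intro!: eq_matI)
  have A'_block: "A' = four_block_mat A1 A2 (0\<^sub>m n 1) A3" using block A0 by simp
  have "char_poly A = char_poly A1 * char_poly A3"
    unfolding char_poly_similar[OF sim] A'_block
    by (rule char_poly_four_block_zeros_col[OF block(1,2,4)])
  then have "char_poly A3 dvd (\<Prod>a\<leftarrow>as. [:- a, 1:])"
    using Suc.prems(2) by (metis dvd_mult_right)
  then obtain B where B: "B \<in> carrier_mat n n" "upper_triangular B" "similar_mat A3 B"
    using Suc.IH[OF block(4)] by blast
  then obtain P Q where wit: "similar_mat_wit A3 B P Q" by (auto simp: similar_mat_def)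
  note PQ = similar_mat_witD2[OF block(4) wit]
  \<comment> \<open>Conjugation by the block matrix with diagonal 1 and \<open>P\<close>
    triangularises \<open>A3\<close> and turns \<open>A2\<close> into \<open>A2 * P\<close>; the
    four-block rule expects this factored form.\<close>
  have "A2 = 1\<^sub>m 1 * (A2 * P) * Q"
    using block(2) PQ by (simp add: assoc_mult_mat[of _ 1 n _ n _ n])
  moreover have "0\<^sub>m n 1 = P * 0\<^sub>m n 1 * 1\<^sub>m 1" using PQ by simp
  ultimately have "similar_mat_wit A' (four_block_mat A1 (A2 * P) (0\<^sub>m n 1) B)
      (four_block_mat (1\<^sub>m 1) (0\<^sub>m 1 n) (0\<^sub>m n 1) P) (four_block_mat (1\<^sub>m 1) (0\<^sub>m 1 n) (0\<^sub>m n 1) Q)"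
    unfolding A'_block
    by (rule similar_mat_wit_four_block[OF similar_mat_wit_refl[OF block(1)] wit _ _ block(1,4)])
      (use block PQ in auto)
  then have "similar_mat A' (four_block_mat A1 (A2 * P) (0\<^sub>m n 1) B)"
    unfolding similar_mat_def by blast
  then have "similar_mat A (four_block_mat A1 (A2 * P) (0\<^sub>m n 1) B)"
    by (rule similar_mat_trans[OF sim])
  moreover have "upper_triangular (four_block_mat A1 (A2 * P) (0\<^sub>m n 1) B)"
    by (rule upper_triangular_four_block[OF block(1) B(1) _ B(2)]) (use block in auto)
  moreover have "four_block_mat A1 (A2 * P) (0\<^sub>m n 1) B \<in> carrier_mat (Suc n) (Suc n)"
    using four_block_carrier_mat[OF block(1) B(1)] by simp
  ultimately show ?case by blast
qed

lemma jordan_nf_exists_field: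
  fixes A :: "'a :: field mat"
  assumes "A \<in> carrier_mat n n" "char_poly A dvd (\<Prod>a\<leftarrow>as. [:- a, 1:])"
  shows "\<exists>n_as. jordan_nf A n_as"
proof -
  obtain B where B: "B \<in> carrier_mat n n" "upper_triangular B" "similar_mat A B"
    using similar_upper_triangular[OF assms] by blast
  have "jordan_nf B (triangular_to_jnf_vector B)" by (rule triangular_to_jnf_vector[OF B(1,2)])
  then show ?thesis using similar_mat_trans[OF B(3)] by (auto simp: jordan_nf_def)
qed

section \<open>Symplectic matrices\<close>

lemma uminus_zero_mat [simp]: "- 0\<^sub>m n m = (0\<^sub>m n m :: 'a :: group_add mat)"
  by (intro eq_matI) auto

lemma Omega_carrier [simp]: "Omega n \<in> carrier_mat (2 * n) (2 * n)"
  unfolding Omega_def by (metis four_block_carrier_mat mult_2 zero_carrier_mat)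

lemma dim_Omega [simp]: "dim_row (Omega n) = 2 * n" "dim_col (Omega n) = 2 * n"
  using Omega_carrier[of n] by (auto simp del: Omega_carrier)

lemma index_Omega:
  assumes "i < 2 * n" "j < 2 * n"
  shows "Omega n $$ (i, j) = (if j = n + i then 1 else if i = n + j then - 1 else 0)"
  using assms by (auto simp: Omega_def)

lemma Omega_square: "Omega n * Omega n = - (1\<^sub>m (2 * n) :: 'a :: comm_ring_1 mat)"
proof -
  have "four_block_mat (- 1\<^sub>m n) (0\<^sub>m n n) (0\<^sub>m n n) (- 1\<^sub>m n) = - (1\<^sub>m (2 * n) :: 'a mat)"
    by (intro eq_matI) auto
  then show ?thesis
    unfolding Omega_def
    by (subst mult_four_block_mat[of _ n n _ n _ n _ _ n _ n]) auto
qed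

lemma minus_Omega_inverse:
  "- Omega n * Omega n = (1\<^sub>m (2 * n) :: 'a :: comm_ring_1 mat)"
  "Omega n * - Omega n = (1\<^sub>m (2 * n) :: 'a mat)"
proof -
  have "- (- 1\<^sub>m (2 * n)) = (1\<^sub>m (2 * n) :: 'a mat)" by (intro eq_matI) auto
  then show "- Omega n * Omega n = (1\<^sub>m (2 * n) :: 'a mat)"
    "Omega n * - Omega n = (1\<^sub>m (2 * n) :: 'a mat)"
    by (simp_all add: Omega_square)
qed

lemma mat_inv_Omega: "mat_inv (Omega n) = - Omega n"
  by (rule mat_inv_eqI[OF Omega_carrier _ minus_Omega_inverse(2,1)]) simp

text \<open>Multiplying the defining equation by the inverse \<open>- Omega n\<close> of
  \<open>Omega n\<close> exhibits an explicit inverse of \<open>C\<close>.\<close>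

lemma symplectic_left_inverse:
  fixes C :: "'a :: field mat"
  assumes "symplectic n C"
  shows "(- Omega n * (C\<^sup>T * Omega n)) * C = 1\<^sub>m (2 * n)"
proof -
  have C: "C \<in> carrier_mat (2 * n) (2 * n)" "C\<^sup>T * Omega n * C = Omega n"
    using assms by (auto simp: symplectic_def)
  have "(- Omega n * (C\<^sup>T * Omega n)) * C = - Omega n * (C\<^sup>T * Omega n * C)"
    using C(1) by (intro assoc_mult_mat[of _ "2 * n" "2 * n" _ "2 * n" _ "2 * n"]) auto
  then show ?thesis using C(2) minus_Omega_inverse by simp
qed

lemma symplectic_mat_inv:
  fixes C :: "'a :: field mat"
  assumes "symplectic n C"
  shows "mat_inv C \<in> carrier_mat (2 * n) (2 * n)" "mat_inv C * C = 1\<^sub>m (2 * n)" "C * mat_inv C = 1\<^sub>m (2 * n)"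
proof -
  define L where "L = - Omega n * (C\<^sup>T * Omega n)"
  have C: "C \<in> carrier_mat (2 * n) (2 * n)" using assms by (simp add: symplectic_def)
  then have L: "L \<in> carrier_mat (2 * n) (2 * n)"
    unfolding L_def by (intro mult_carrier_mat[of _ _ "2 * n"]) auto
  have LC: "L * C = 1\<^sub>m (2 * n)" unfolding L_def by (rule symplectic_left_inverse[OF assms])
  then have CL: "C * L = 1\<^sub>m (2 * n)" by (rule mat_mult_left_right_inverse[OF L C])
  have "mat_inv C = L" by (rule mat_inv_eqI[OF C L CL LC])
  then show "mat_inv C \<in> carrier_mat (2 * n) (2 * n)" "mat_inv C * C = 1\<^sub>m (2 * n)"
    "C * mat_inv C = 1\<^sub>m (2 * n)"
    using L LC CL by auto
qed

text \<open>Allows the later computations to work with \<open>A * C = C * D\<close>, free of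
  inverses.\<close>

lemma symplectic_conjugate:
  fixes C :: "'a :: field mat"
  assumes "symplectic n C" "A \<in> carrier_mat (2 * n) (2 * n)" "D \<in> carrier_mat (2 * n) (2 * n)"
    and "A * C = C * D"
  shows "mat_inv C * A * C = D"
proof -
  have C: "C \<in> carrier_mat (2 * n) (2 * n)" using assms(1) by (simp add: symplectic_def)
  note inv = symplectic_mat_inv[OF assms(1)]
  have "mat_inv C * A * C = mat_inv C * (A * C)"
    by (rule assoc_mult_mat[OF inv(1) assms(2) C])
  also have "\<dots> = mat_inv C * C * D"
    unfolding assms(4) by (rule assoc_mult_mat[symmetric, OF inv(1) C assms(3)])
  finally show ?thesis using inv(2) assms(3) by simp
qed

lemma char_poly_block_diagonal:
  fixes A D :: "'a :: field mat"
  assumes A: "A \<in> carrier_mat n n" and D: "D \<in> carrier_mat m m"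
  shows "char_poly (four_block_mat A (0\<^sub>m n m) (0\<^sub>m m n) D) = char_poly A * char_poly D"
proof -
  \<comment> \<open>The characteristic matrix written out, so that its block structure can be
    checked entrywise.\<close>
  let ?cm = "\<lambda>A. [:0, 1:] \<cdot>\<^sub>m 1\<^sub>m (dim_row A) + map_mat (\<lambda>a. [:- a:]) A"
  have "?cm (four_block_mat A (0\<^sub>m n m) (0\<^sub>m m n) D) =
      four_block_mat (?cm A) (0\<^sub>m n m) (0\<^sub>m m n) (?cm D)"
    using A D by (intro eq_matI) auto
  then show ?thesis
    unfolding char_poly_defs using A D
    by (simp add: det_four_block_mat_lower_left_zero[of _ n _ m])
qed

section \<open>The symplectic space of coordinate functions\<close>

lemma sum_apply: "(\<Sum>i\<in>I. F i) x = (\<Sum>i\<in>I. F i x)"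
  for F :: "'i \<Rightarrow> 'b \<Rightarrow> 'c :: comm_monoid_add"
  by (induction I rule: infinite_finite_induct) auto

lemma sum_lessThan_add: "(\<Sum>l<n + m. f l) = (\<Sum>l<n. f l) + (\<Sum>l<m. f (n + l))"
  for f :: "nat \<Rightarrow> 'a :: comm_monoid_add"
  by (induction m) (auto simp: add.assoc)

text \<open>Functions on \<open>nat\<close> form an abelian group as a type, whereas
  \<open>'a vec\<close> mixes dimensions. Vectors of length \<open>2 * n\<close> become functions
  that vanish from \<open>2 * n\<close> on.\<close>

definition fun_scale :: "'a :: field \<Rightarrow> (nat \<Rightarrow> 'a) \<Rightarrow> nat \<Rightarrow> 'a" where
  "fun_scale c f = (\<lambda>i. c * f i)"

definition unit_funs :: "nat \<Rightarrow> (nat \<Rightarrow> 'a :: field) set" where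
  "unit_funs n = (\<lambda>i j. of_bool (i = j)) ` {..<2 * n}"

definition symplectic_form :: "nat \<Rightarrow> (nat \<Rightarrow> 'a :: field) \<Rightarrow> (nat \<Rightarrow> 'a) \<Rightarrow> 'a" where
  "symplectic_form n f g = (\<Sum>i<n. f i * g (n + i) - f (n + i) * g i)"

text \<open>The cutoff to 0 keeps every image inside the span of \<open>unit_funs n\<close>.\<close>

definition mat_fun :: "nat \<Rightarrow> 'a :: field mat \<Rightarrow> (nat \<Rightarrow> 'a) \<Rightarrow> nat \<Rightarrow> 'a" where
  "mat_fun n A f = (\<lambda>i. if i < 2 * n then \<Sum>j<2 * n. A $$ (i, j) * f j else 0)"

lemma vector_space_fun_scale: "vector_space (fun_scale :: 'a :: field \<Rightarrow> _)"
  by unfold_locales (auto simp: fun_scale_def algebra_simps fun_eq_iff)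

interpretation fun_vs: vector_space "fun_scale :: 'a :: field \<Rightarrow> _"
  by (rule vector_space_fun_scale)

lemma span_unit_funs: "fun_vs.span (unit_funs n) = {f :: nat \<Rightarrow> 'a :: field. \<forall>i\<ge>2 * n. f i = 0}"
proof (intro subset_antisym)
  show "fun_vs.span (unit_funs n) \<subseteq> {f :: nat \<Rightarrow> 'a. \<forall>i\<ge>2 * n. f i = 0}"
    by (rule fun_vs.span_minimal)
      (auto simp: unit_funs_def fun_vs.subspace_def fun_scale_def)
  show "{f :: nat \<Rightarrow> 'a. \<forall>i\<ge>2 * n. f i = 0} \<subseteq> fun_vs.span (unit_funs n)"
  proof
    fix f :: "nat \<Rightarrow> 'a" assume f: "f \<in> {f. \<forall>i\<ge>2 * n. f i = 0}"
    have "f = (\<Sum>i<2 * n. fun_scale (f i) (\<lambda>j. of_bool (i = j)))"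
    proof
      fix j
      have "(\<Sum>i<2 * n. f i * of_bool (i = j)) = (\<Sum>i<2 * n. if i = j then f i else 0)"
        by (intro sum.cong) auto
      also have "\<dots> = f j" using f by (cases "j < 2 * n") auto
      finally show "f j = (\<Sum>i<2 * n. fun_scale (f i) (\<lambda>j. of_bool (i = j))) j"
        by (simp add: sum_apply fun_scale_def)
    qed
    also have "\<dots> \<in> fun_vs.span (unit_funs n)"
      by (intro fun_vs.span_sum fun_vs.span_scale fun_vs.span_base) (auto simp: unit_funs_def)
    finally show "f \<in> fun_vs.span (unit_funs n)" .
  qed
qed

lemma independent_unit_funs: "fun_vs.independent (unit_funs n :: (nat \<Rightarrow> 'a :: field) set)"
  unfolding fun_vs.dependent_def
proof (rule notI, elim bexE)
  fix e :: "nat \<Rightarrow> 'a" assume e: "e \<in> unit_funs n" "e \<in> fun_vs.span (unit_funs n - {e})"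
  obtain i where i: "e = (\<lambda>j. of_bool (i = j))" using e(1) by (auto simp: unit_funs_def)
  have "fun_vs.span (unit_funs n - {e}) \<subseteq> {f. f i = 0}"
    by (rule fun_vs.span_minimal)
      (auto simp: unit_funs_def i fun_vs.subspace_def fun_scale_def)
  then show False using e(2) by (auto simp: i)
qed

lemma card_unit_funs: "card (unit_funs n :: (nat \<Rightarrow> 'a :: field) set) = 2 * n"
proof -
  have "inj (\<lambda>(i :: nat) j. of_bool (i = j) :: 'a)"
  proof (rule injI)
    fix i j :: nat assume "(\<lambda>l. of_bool (i = l) :: 'a) = (\<lambda>l. of_bool (j = l))"
    from fun_cong[OF this, of i] show "i = j" by (simp split: if_splits)
  qed
  then show ?thesis unfolding unit_funs_def by (subst card_image) (auto intro: inj_on_subset)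
qed

lemma symplectic_form_Omega:
  "symplectic_form n f g = vec (2 * n) f \<bullet> (Omega n *\<^sub>v vec (2 * n) g)"
proof -
  have row: "(Omega n *\<^sub>v vec (2 * n) g) $ i = (if i < n then g (n + i) else - g (i - n))"
    if i: "i < 2 * n" for i
  proof -
    have "(Omega n *\<^sub>v vec (2 * n) g) $ i = (\<Sum>j<2 * n. Omega n $$ (i, j) * g j)"
      using i by (simp add: scalar_prod_def atLeast0LessThan)
    also have "\<dots> = (\<Sum>j<2 * n. if j = (if i < n then n + i else i - n)
        then if i < n then g (n + i) else - g (i - n) else 0)"
      using i by (intro sum.cong) (auto simp: index_Omega)
    also have "\<dots> = (if i < n then g (n + i) else - g (i - n))" using i by auto
    finally show ?thesis .
  qed
  have "vec (2 * n) f \<bullet> (Omega n *\<^sub>v vec (2 * n) g) =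
      (\<Sum>i<2 * n. f i * (if i < n then g (n + i) else - g (i - n)))"
    using row by (simp add: scalar_prod_def atLeast0LessThan)
  also have "\<dots> = symplectic_form n f g"
    by (simp add: mult_2 sum_lessThan_add symplectic_form_def sum_subtractf sum_negf)
  finally show ?thesis by simp
qed

lemma vec_mat_fun:
  assumes "A \<in> carrier_mat (2 * n) (2 * n)"
  shows "vec (2 * n) (mat_fun n A f) = A *\<^sub>v vec (2 * n) f"
  using assms by (intro eq_vecI) (auto simp: mat_fun_def scalar_prod_def atLeast0LessThan)

text \<open>The matrix identity \<open>A_Omega\<close> says precisely that \<open>A\<close> is
  self-adjoint for the form, once \<open>symplectic_form_Omega\<close> has turned the form into a
  scalar product.\<close>

lemma selfadjoint_form_mat_fun:
  fixes A :: "'a :: field mat"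
  assumes two: "(2 :: 'a) \<noteq> 0" and A: "A \<in> carrier_mat (2 * n) (2 * n)"
    and A_Omega: "A\<^sup>T * Omega n = Omega n * A"
  shows "selfadjoint_form fun_scale (unit_funs n) (symplectic_form n) (mat_fun n A)"
proof unfold_locales
  fix f g h :: "nat \<Rightarrow> 'a" and c :: 'a
  show "finite (unit_funs n :: (nat \<Rightarrow> 'a) set)" by (simp add: unit_funs_def)
  show "fun_vs.independent (unit_funs n :: (nat \<Rightarrow> 'a) set)" by (rule independent_unit_funs)
  show "symplectic_form n (f + g) h = symplectic_form n f h + symplectic_form n g h"
    by (simp add: symplectic_form_def sum.distrib[symmetric] algebra_simps)
  show "symplectic_form n (fun_scale c f) h = c * symplectic_form n f h"
    by (simp add: symplectic_form_def fun_scale_def sum_distrib_left algebra_simps)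
  show "symplectic_form n f g = - symplectic_form n g f"
    by (simp add: symplectic_form_def sum_negf[symmetric] algebra_simps)
  show "mat_fun n A (f + g) = mat_fun n A f + mat_fun n A g"
    by (auto simp: mat_fun_def fun_eq_iff sum.distrib algebra_simps)
  show "mat_fun n A (fun_scale c f) = fun_scale c (mat_fun n A f)"
    by (auto simp: mat_fun_def fun_scale_def fun_eq_iff sum_distrib_left algebra_simps)
  show "mat_fun n A f \<in> fun_vs.span (unit_funs n)"
    by (simp add: span_unit_funs mat_fun_def)
  let ?f = "vec (2 * n) f" and ?g = "vec (2 * n) g"
  have "symplectic_form n (mat_fun n A f) g = (A *\<^sub>v ?f) \<bullet> (Omega n *\<^sub>v ?g)"
    by (simp only: symplectic_form_Omega vec_mat_fun[OF A])
  also have "\<dots> = (Omega n *\<^sub>v ?g) \<bullet> (A *\<^sub>v ?f)"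
    using A by (intro comm_scalar_prod[of _ "2 * n"]) (auto intro!: mult_mat_vec_carrier)
  also have "\<dots> = (A\<^sup>T *\<^sub>v (Omega n *\<^sub>v ?g)) \<bullet> ?f"
    using A by (intro transpose_vec_mult_scalar[symmetric]) (auto intro!: mult_mat_vec_carrier)
  also have "A\<^sup>T *\<^sub>v (Omega n *\<^sub>v ?g) = (A\<^sup>T * Omega n) *\<^sub>v ?g"
    using A by (intro assoc_mult_mat_vec[symmetric]) auto
  also have "\<dots> = Omega n *\<^sub>v (A *\<^sub>v ?g)"
    unfolding A_Omega using A by (intro assoc_mult_mat_vec) auto
  also have "(Omega n *\<^sub>v (A *\<^sub>v ?g)) \<bullet> ?f = ?f \<bullet> (Omega n *\<^sub>v (A *\<^sub>v ?g))"
    using A by (intro comm_scalar_prod[of _ "2 * n"]) (auto intro!: mult_mat_vec_carrier)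
  also have "\<dots> = symplectic_form n f (mat_fun n A g)"
    by (simp only: symplectic_form_Omega vec_mat_fun[OF A])
  finally show "symplectic_form n (mat_fun n A f) g = symplectic_form n f (mat_fun n A g)" .
next
  fix f :: "nat \<Rightarrow> 'a" assume f: "f \<in> fun_vs.span (unit_funs n)" "f \<noteq> 0"
  obtain i where "f i \<noteq> 0" using f(2) by (auto simp: fun_eq_iff)
  then have i: "i < 2 * n" "f i \<noteq> 0" using f(1) by (auto simp: span_unit_funs not_less[symmetric])
  then have i_minus: "\<not> i < n \<Longrightarrow> i - n < n" by linarith
  \<comment> \<open>\<open>j\<close> is the partner of \<open>i\<close> under
    \<open>Omega n\<close>, so pairing \<open>f\<close> with the unit function at \<open>j\<close>
    isolates \<open>f i\<close> up to sign.\<close>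
  define j where "j = (if i < n then n + i else i - n)"
  define g where "g = (\<lambda>l. of_bool (j = l) :: 'a)"
  have g: "g \<in> fun_vs.span (unit_funs n)" using i by (auto simp: span_unit_funs g_def j_def)
  have "symplectic_form n f g = (\<Sum>l<n. if l = (if i < n then i else i - n) then if i < n then f i else - f i else 0)"
    unfolding symplectic_form_def g_def j_def using i by (intro sum.cong) auto
  also have "\<dots> = (if i < n then f i else - f i)" using i i_minus by simp
  finally have "symplectic_form n f g \<noteq> 0" using i by simp
  then show "\<exists>g\<in>fun_vs.span (unit_funs n). symplectic_form n f g \<noteq> 0" using g by blast
qed (rule two)

text \<open>The columns of \<open>C\<close> are the \<open>x i\<close> followed by the
  \<open>y i\<close>. Their Gram matrix is \<open>Omega n\<close>, and the action of
  \<open>A\<close> on the two halves is given by \<open>b\<close> and its transpose.\<close>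

lemma symplectic_block_form:
  fixes A :: "'a :: field mat"
  assumes two: "(2 :: 'a) \<noteq> 0" and A: "A \<in> carrier_mat (2 * n) (2 * n)"
    and A_Omega: "A\<^sup>T * Omega n = Omega n * A"
  shows "\<exists>C B. symplectic n C \<and> B \<in> carrier_mat n n \<and>
    A * C = C * four_block_mat B (0\<^sub>m n n) (0\<^sub>m n n) B\<^sup>T"
proof -
  interpret selfadjoint_form fun_scale "unit_funs n" "symplectic_form n" "mat_fun n A"
    by (rule selfadjoint_form_mat_fun[OF assms])
  obtain x y b where
    T_x: "\<And>i. i < n \<Longrightarrow> mat_fun n A (x i) = (\<Sum>j<n. fun_scale (b j i) (x j))"
    and T_y: "\<And>i. i < n \<Longrightarrow> mat_fun n A (y i) = (\<Sum>j<n. fun_scale (b i j) (y j))"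
    and xx: "\<And>i j. i < n \<Longrightarrow> j < n \<Longrightarrow> symplectic_form n (x i) (x j) = 0"
    and yy: "\<And>i j. i < n \<Longrightarrow> j < n \<Longrightarrow> symplectic_form n (y i) (y j) = 0"
    and xy: "\<And>i j. i < n \<Longrightarrow> j < n \<Longrightarrow> symplectic_form n (x i) (y j) = of_bool (i = j)"
    using hyperbolic_basis[OF card_unit_funs] by blast
  define c where "c j = (if j < n then x j else y (j - n))" for j
  define C where "C = mat (2 * n) (2 * n) (\<lambda>(i, j). c j i)"
  define B where "B = mat n n (\<lambda>(i, j). b i j)"
  define D where "D = four_block_mat B (0\<^sub>m n n) (0\<^sub>m n n) B\<^sup>T"
  have C: "C \<in> carrier_mat (2 * n) (2 * n)" and B: "B \<in> carrier_mat n n"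
    by (simp_all add: C_def B_def)
  have D: "D \<in> carrier_mat (2 * n) (2 * n)"
    unfolding D_def mult_2 using B by (intro four_block_carrier_mat) auto
  have col: "col C j = vec (2 * n) (c j)" if "j < 2 * n" for j
    using that by (intro eq_vecI) (auto simp: C_def)
  have form: "symplectic_form n (c i) (c j) = Omega n $$ (i, j)" if "i < 2 * n" "j < 2 * n" for i j
    using that form_skew[of "y (i - n)" "x j"] by (auto simp: index_Omega c_def xx yy xy)
  have "C\<^sup>T * Omega n * C = Omega n"
  proof (rule eq_matI)
    fix i j assume "i < dim_row (Omega n :: 'a mat)" "j < dim_col (Omega n :: 'a mat)"
    then have ij: "i < 2 * n" "j < 2 * n" by auto
    have "(C\<^sup>T * Omega n * C) $$ (i, j) = (C\<^sup>T * (Omega n * C)) $$ (i, j)"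
      using C by (simp add: assoc_mult_mat[of _ "2 * n" "2 * n" _ "2 * n" _ "2 * n"])
    also have "\<dots> = col C i \<bullet> (Omega n *\<^sub>v col C j)"
      using ij C by (simp add: col_mult2[of _ "2 * n" "2 * n" _ "2 * n"])
    also have "\<dots> = Omega n $$ (i, j)"
      using form[OF ij] by (simp add: col ij symplectic_form_Omega)
    finally show "(C\<^sup>T * Omega n * C) $$ (i, j) = Omega n $$ (i, j)" .
  qed (use C in auto)
  then have "symplectic n C" using C by (simp add: symplectic_def)
  moreover have "A * C = C * D"
  proof (rule eq_matI)
    fix i j assume "i < dim_row (C * D)" "j < dim_col (C * D)"
    then have ij: "i < 2 * n" "j < 2 * n" using C D by auto
    have "(A * C) $$ (i, j) = (A *\<^sub>v col C j) $ i" using ij A C by simp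
    also have "\<dots> = mat_fun n A (c j) i"
      using ij by (simp only: col vec_mat_fun[OF A, symmetric] index_vec)
    also have "\<dots> = (\<Sum>l<2 * n. D $$ (l, j) * c l i)"
    proof (cases "j < n")
      case True
      then show ?thesis using B ij
        by (simp add: c_def T_x sum_apply fun_scale_def mult_2 sum_lessThan_add D_def)
          (simp add: B_def)
    next
      case False
      then show ?thesis using B ij
        by (simp add: c_def T_y sum_apply fun_scale_def mult_2 sum_lessThan_add D_def)
          (simp add: B_def)
    qed
    also have "\<dots> = (C * D) $$ (i, j)"
      using ij C D by (simp add: scalar_prod_def atLeast0LessThan C_def mult.commute)
    finally show "(A * C) $$ (i, j) = (C * D) $$ (i, j)" .
  qed (use A C D in auto)
  ultimately show ?thesis using B unfolding D_def by blast
qed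

section \<open>Change of basis inside the two blocks\<close>

lemma symplectic_block_diagonal:
  fixes P Q :: "'a :: field mat"
  assumes P: "P \<in> carrier_mat n n" and Q: "Q \<in> carrier_mat n n" and "Q * P = 1\<^sub>m n"
  shows "symplectic n (four_block_mat P (0\<^sub>m n n) (0\<^sub>m n n) Q\<^sup>T)"
proof -
  \<comment> \<open>The off-diagonal blocks of the product are \<open>P\<^sup>T * Q\<^sup>T\<close>
    and \<open>- (Q * P)\<close>, so both forms of the inverse relation enter.\<close>
  have "P\<^sup>T * Q\<^sup>T = 1\<^sub>m n"
    using assms by (metis transpose_mult transpose_one)
  then have "(four_block_mat P (0\<^sub>m n n) (0\<^sub>m n n) Q\<^sup>T)\<^sup>T * Omega n * four_block_mat P (0\<^sub>m n n) (0\<^sub>m n n) Q\<^sup>T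
      = Omega n"
    unfolding Omega_def using assms
    by (simp add: transpose_four_block_mat[of _ n n _ n _ n] mult_four_block_mat[of _ n n _ n _ n _ _ n _ n])
  moreover have "four_block_mat P (0\<^sub>m n n) (0\<^sub>m n n) Q\<^sup>T \<in> carrier_mat (2 * n) (2 * n)"
    unfolding mult_2 using P Q by (intro four_block_carrier_mat) auto
  ultimately show ?thesis by (simp add: symplectic_def)
qed

lemma symplectic_mult:
  fixes C S :: "'a :: field mat"
  assumes "symplectic n C" "symplectic n S"
  shows "symplectic n (C * S)"
proof -
  have C: "C \<in> carrier_mat (2 * n) (2 * n)" "C\<^sup>T * Omega n * C = Omega n"
    and S: "S \<in> carrier_mat (2 * n) (2 * n)" "S\<^sup>T * Omega n * S = Omega n"
    using assms by (auto simp: symplectic_def)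
  have "(C * S)\<^sup>T * Omega n * (C * S) = S\<^sup>T * (C\<^sup>T * Omega n * C) * S"
    using C(1) S(1) mult_carrier_mat[OF transpose_carrier_mat[THEN iffD2, OF C(1)] Omega_carrier]
      mult_carrier_mat[OF Omega_carrier C(1)] mult_carrier_mat[OF C(1) S(1)]
    by (simp add: transpose_mult[of _ "2 * n" "2 * n" _ "2 * n"] assoc_mult_mat[of _ "2 * n" "2 * n" _ "2 * n" _ "2 * n"])
  then show ?thesis using C S by (simp add: symplectic_def)
qed

lemma block_diagonal_similar:
  fixes B :: "'a :: field mat"
  assumes "similar_mat_wit B J P Q" "B \<in> carrier_mat n n"
  shows "four_block_mat B (0\<^sub>m n n) (0\<^sub>m n n) B\<^sup>T * four_block_mat P (0\<^sub>m n n) (0\<^sub>m n n) Q\<^sup>T =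
    four_block_mat P (0\<^sub>m n n) (0\<^sub>m n n) Q\<^sup>T * four_block_mat J (0\<^sub>m n n) (0\<^sub>m n n) J\<^sup>T"
proof -
  note wit = similar_mat_witD2[OF assms(2,1)]
  have "B * P = P * J * (Q * P)"
    using wit(3-) by (simp add: assoc_mult_mat[of _ n n _ n _ n])
  then have BP: "B * P = P * J" using wit by simp
  have "Q * B = (Q * P) * J * Q"
    using wit(3-) by (simp add: assoc_mult_mat[of _ n n _ n _ n])
  then have "Q * B = J * Q" using wit by simp
  \<comment> \<open>Transposing settles the lower block: \<open>Q\<^sup>T\<close> conjugates
    \<open>B\<^sup>T\<close> to \<open>J\<^sup>T\<close>.\<close>
  then have "B\<^sup>T * Q\<^sup>T = Q\<^sup>T * J\<^sup>T" using wit by (metis transpose_mult)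
  then show ?thesis using BP wit(4-)
    by (simp add: mult_four_block_mat[of _ n n _ n _ n _ _ n _ n])
qed

theorem theorem1:
  fixes A :: "'a :: field mat" and n :: nat
  assumes "CHAR('a) \<noteq> 2"
    and "n > 0"
    and "A \<in> carrier_mat (2 * n) (2 * n)"
    and "A\<^sup>T = Omega n * A * mat_inv (Omega n)"
  shows "(all_eigenvalues_in_field A \<longrightarrow>
           (\<exists>C B. symplectic n C \<and> B \<in> carrier_mat n n \<and> in_jordan_normal_form B \<and>
              mat_inv C * A * C = four_block_mat B (0\<^sub>m n n) (0\<^sub>m n n) B\<^sup>T)) \<and>
         (perfect_field TYPE('a) \<longrightarrow>
           (\<exists>C B. symplectic n C \<and> B \<in> carrier_mat n n \<and>
              mat_inv C * A * C = four_block_mat B (0\<^sub>m n n) (0\<^sub>m n n) B\<^sup>T))"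
proof -
  note A = assms(3)
  have two: "(2 :: 'a) \<noteq> 0"
  proof
    assume "(2 :: 'a) = 0"
    then have "of_nat 2 = (0 :: 'a)" by simp
    then have "CHAR('a) dvd 2" by (simp only: of_nat_eq_0_iff_char_dvd)
    moreover have "CHAR('a) \<noteq> 1" by simp
    ultimately show False using assms(1) by (metis prime_nat_iff two_is_prime_nat)
  qed
  \<comment> \<open>Multiplication on the right by \<open>Omega n\<close> removes the inverse and
    brings the hypothesis into self-adjoint form.\<close>
  have "A\<^sup>T * Omega n = Omega n * A * (- Omega n * Omega n)"
    unfolding assms(4) mat_inv_Omega using A
    by (intro assoc_mult_mat[of _ "2 * n" "2 * n" _ "2 * n" _ "2 * n"]) auto
  then have "A\<^sup>T * Omega n = Omega n * A" using A by (simp add: minus_Omega_inverse)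
  then obtain C B where C: "symplectic n C" and B: "B \<in> carrier_mat n n"
    and AC: "A * C = C * four_block_mat B (0\<^sub>m n n) (0\<^sub>m n n) B\<^sup>T"
    using symplectic_block_form[OF two A] by blast
  have diag_carrier: "four_block_mat M (0\<^sub>m n n) (0\<^sub>m n n) M\<^sup>T \<in> carrier_mat (2 * n) (2 * n)"
    if "M \<in> carrier_mat n n" for M :: "'a mat"
    unfolding mult_2 using that by (intro four_block_carrier_mat) auto
  let ?D = "four_block_mat B (0\<^sub>m n n) (0\<^sub>m n n) B\<^sup>T"
  have C_carrier: "C \<in> carrier_mat (2 * n) (2 * n)" using C by (simp add: symplectic_def)
  have conj: "mat_inv C * A * C = ?D"
    by (rule symplectic_conjugate[OF C A diag_carrier[OF B] AC])
  moreover have "\<exists>C B. symplectic n C \<and> B \<in> carrier_mat n n \<and> in_jordan_normal_form B \<and>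
      mat_inv C * A * C = four_block_mat B (0\<^sub>m n n) (0\<^sub>m n n) B\<^sup>T"
    if "all_eigenvalues_in_field A"
  proof -
    note inv = symplectic_mat_inv[OF C]
    \<comment> \<open>Similarity transfers splitting from \<open>A\<close> to \<open>B\<close>,
      whose characteristic polynomial is a factor of that of the block diagonal matrix.\<close>
    have "similar_mat_wit ?D A (mat_inv C) C"
      using conj inv A C_carrier diag_carrier[OF B] by (intro similar_mat_witI[of _ _ "2 * n"]) auto
    then have "char_poly ?D = char_poly A" using char_poly_similar unfolding similar_mat_def by blast
    then have "char_poly B * char_poly B\<^sup>T = char_poly A"
      using char_poly_block_diagonal[OF B, of "B\<^sup>T" n] B by simp
    then have "char_poly B dvd char_poly A" by (metis dvd_triv_left)
    then obtain n_as where "jordan_nf B n_as"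
      using jordan_nf_exists_field[OF B] \<open>all_eigenvalues_in_field A\<close>
      unfolding all_eigenvalues_in_field_def by metis
    then obtain P Q where n_as: "0 \<notin> fst ` set n_as"
      and wit: "similar_mat_wit B (jordan_matrix n_as) P Q"
      by (auto simp: jordan_nf_def similar_mat_def)
    let ?J = "jordan_matrix n_as"
    let ?S = "four_block_mat P (0\<^sub>m n n) (0\<^sub>m n n) Q\<^sup>T"
    let ?E = "four_block_mat ?J (0\<^sub>m n n) (0\<^sub>m n n) ?J\<^sup>T"
    note PQ = similar_mat_witD2[OF B wit]
    have S: "symplectic n ?S" by (rule symplectic_block_diagonal[OF PQ(6,7,2)])
    then have S_carrier: "?S \<in> carrier_mat (2 * n) (2 * n)" by (simp add: symplectic_def)
    have "A * (C * ?S) = A * C * ?S"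
      by (rule assoc_mult_mat[symmetric, OF A C_carrier S_carrier])
    also have "\<dots> = C * (?D * ?S)"
      unfolding AC by (rule assoc_mult_mat[OF C_carrier diag_carrier[OF B] S_carrier])
    also have "\<dots> = C * (?S * ?E)" by (simp only: block_diagonal_similar[OF wit B])
    also have "\<dots> = C * ?S * ?E"
      by (rule assoc_mult_mat[symmetric, OF C_carrier S_carrier diag_carrier[OF PQ(5)]])
    finally have "mat_inv (C * ?S) * A * (C * ?S) = ?E"
      by (rule symplectic_conjugate[OF symplectic_mult[OF C S] A diag_carrier[OF PQ(5)]])
    then show ?thesis using symplectic_mult[OF C S] PQ(5) n_as
      unfolding in_jordan_normal_form_def by blast
  qed
  ultimately show ?thesis using C B by blast
qed

end
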